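(* Let $G$ be a finite simple graph with no isolated vertices that is $C_6$-free and not isomorphic to any of the following graphs. Each is built on a $5$-cycle with vertices $r,s,t,u,v$ and edges $rs,st,tu,uv,vr$, together with an independent set of additional vertices whose neighbourhoods (all contained in $\{r,s,t,u,v\}$) are prescribed: (1) one vertex with neighbourhood $\{r,t,u\}$ and one with neighbourhood $\{s,t,u,v\}$; (2) for any $k\ge 0$: one vertex with neighbourhood $\{r,t,u\}$, one with $\{s,u,v\}$, and $k$ vertices with $\{r,s,u\}$; (3) for any $k\ge 0$: one vertex with neighbourhood $\{r,s,t,u\}$, one with $\{s,t,u,v\}$, and $k$ vertices with $\{r,t,v\}$; (4) for any $a,b,c\ge 0$: $a$ vertices with neighbourhood $\{r,t\}$, $b$ with $\{r,u\}$, and $c$ with $\{r,t,u\}$; (5) for any $a,b,c,d\ge 0$: $a$ vertices with neighbourhood $\{r,t\}$, $b$ with $\{r,t,u\}$, $c$ with $\{r,t,v\}$, and $d$ with $\{r,t,u,v\}$; (6) for any $a,b,c,d,f\ge 0$: $a$ vertices with neighbourhood $\{r,t,u\}$, $b$ with $\{r,t,v\}$, $c$ with $\{r,s,t,u\}$, $d$ with $\{r,t,u,v\}$, and $f$ with $\{r,s,t,u,v\}$. Then $G$ is $C_5$-free if and only if $G/e$ is $C_5$-free for every edge $e\in E(G)$.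
   Context: All graphs are finite and simple. $C_n$ is the cycle on $n$ vertices. A graph is $H$-free if it has no induced subgraph isomorphic to $H$. For an edge $e=uv$ of $G$, the contraction $G/e$ is obtained from $G$ by deleting $u$ and $v$ and adding a new vertex adjacent to every vertex of $(N(u)\cup N(v))\setminus\{u,v\}$. *)

theory Defs
  imports "Graph_Theory.Graph_Theory"
begin

text \<open>
  Finite simple graphs are the \<^locale>\<open>pair_graph\<close>s: finite vertex set, no loops, and a
  symmetric arc relation, so that an edge \<open>uv\<close> is represented by the two arcs
  \<open>(u, v)\<close> and \<open>(v, u)\<close>. The library notions \<^const>\<open>digraph_iso\<close> and
  \<^const>\<open>induced_subgraph\<close> apply to them through \<^const>\<open>with_proj\<close>.
\<close>

definition graph_iso :: "'a pair_pre_digraph \<Rightarrow> 'b pair_pre_digraph \<Rightarrow> bool" where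
  "graph_iso G H \<longleftrightarrow> digraph_iso (with_proj G) (with_proj H)"

lemma graph_iso_iff:
  assumes "pair_wf_digraph G" "pair_wf_digraph H"
  shows "graph_iso G H \<longleftrightarrow>
    (\<exists>f. bij_betw f (pverts G) (pverts H) \<and>
      (\<forall>x \<in> pverts G. \<forall>y \<in> pverts G. (x, y) \<in> parcs G \<longleftrightarrow> (f x, f y) \<in> parcs H))"
    (is "_ \<longleftrightarrow> (\<exists>f. ?P f)")
proof
  interpret G: pair_wf_digraph G by fact
  assume "graph_iso G H"
  then obtain h where h: "G.digraph_isomorphism h" and H: "with_proj H = app_iso h (with_proj G)"
    by (auto simp: graph_iso_def digraph_iso_def)
  let ?f = "iso_verts h"
  have inj: "inj_on ?f (pverts G)"
    and arc: "\<And>e. e \<in> parcs G \<Longrightarrow> ?f (fst e) = iso_tail h (iso_arcs h e)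
                                \<and> ?f (snd e) = iso_head h (iso_arcs h e)"
    using h by (auto simp: G.digraph_isomorphism_def)
  have V: "pverts H = ?f ` pverts G" and E: "parcs H = iso_arcs h ` parcs G"
    and t: "iso_tail h = fst" "iso_head h = snd"
    using arg_cong[OF H, of verts] arg_cong[OF H, of arcs]
      arg_cong[OF H, of tail] arg_cong[OF H, of head] by auto
  have "iso_arcs h e = (?f (fst e), ?f (snd e))" if "e \<in> parcs G" for e
    using arc[OF that] t by (simp add: prod_eq_iff)
  then have E': "parcs H = (\<lambda>e. (?f (fst e), ?f (snd e))) ` parcs G"
    unfolding E by (intro image_cong) auto
  have "(x, y) \<in> parcs G \<longleftrightarrow> (?f x, ?f y) \<in> parcs H"
    if "x \<in> pverts G" "y \<in> pverts G" for x y
  proof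
    assume "(x, y) \<in> parcs G"
    then show "(?f x, ?f y) \<in> parcs H"
      unfolding E' by force
  next
    assume "(?f x, ?f y) \<in> parcs H"
    then obtain x' y' where "(x', y') \<in> parcs G" "?f x = ?f x'" "?f y = ?f y'"
      unfolding E' by force
    then show "(x, y) \<in> parcs G"
      using that inj_onD[OF inj] G.in_arcsD1 G.in_arcsD2 by metis
  qed
  then have "?P ?f"
    using inj V by (simp add: bij_betw_def)
  then show "\<exists>f. ?P f"
    by (rule exI[where x = ?f])
next
  interpret G: pair_wf_digraph G by fact
  interpret H: pair_wf_digraph H by fact
  assume "\<exists>f. ?P f"
  then obtain f where f: "?P f"
    by (elim exE)
  then have inj: "inj_on f (pverts G)" and img: "pverts H = f ` pverts G"
    by (auto simp: bij_betw_def)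
  let ?h = "\<lparr> iso_verts = f, iso_arcs = (\<lambda>e. (f (fst e), f (snd e))),
              iso_head = snd, iso_tail = fst \<rparr>"
  have "inj_on (\<lambda>e. (f (fst e), f (snd e))) (parcs G)"
    by (rule inj_onI)
       (auto simp: prod_eq_iff dest!: inj_onD[OF inj] dest: G.arc_fst_in_verts G.arc_snd_in_verts)
  then have "G.digraph_isomorphism ?h"
    using inj by (auto simp: G.digraph_isomorphism_def intro: G.wf_digraph)
  moreover have "parcs H = (\<lambda>e. (f (fst e), f (snd e))) ` parcs G"
  proof (intro set_eqI iffI)
    fix e assume e: "e \<in> parcs H"
    obtain x y where "x \<in> pverts G" "y \<in> pverts G" "e = (f x, f y)"
      using H.arc_fst_in_verts[OF e] H.arc_snd_in_verts[OF e] img by (cases e) auto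
    then show "e \<in> (\<lambda>e. (f (fst e), f (snd e))) ` parcs G"
      using e f by force
  next
    fix e assume "e \<in> (\<lambda>e. (f (fst e), f (snd e))) ` parcs G"
    then obtain x y where xy: "(x, y) \<in> parcs G" and e: "e = (f x, f y)"
      by auto
    have "x \<in> pverts G" "y \<in> pverts G"
      using G.in_arcsD1[OF xy] G.in_arcsD2[OF xy] .
    then show "e \<in> parcs H"
      using f xy e by simp
  qed
  then have "with_proj H = app_iso ?h (with_proj G)"
    using img by (simp add: app_iso_def with_proj_def)
  ultimately show "graph_iso G H"
    by (auto simp: graph_iso_def digraph_iso_def)
qed

definition induced_free :: "'b pair_pre_digraph \<Rightarrow> 'a pair_pre_digraph \<Rightarrow> bool" where
  "induced_free H G \<longleftrightarrow>
     \<not> (\<exists>K. induced_subgraph K (with_proj G) \<and> digraph_iso K (with_proj H))"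

definition nbhd :: "'a pair_pre_digraph \<Rightarrow> 'a \<Rightarrow> 'a set" where
  "nbhd G v = {w. (v, w) \<in> parcs G}"

definition no_isolated :: "'a pair_pre_digraph \<Rightarrow> bool" where
  "no_isolated G \<longleftrightarrow> (\<forall>v \<in> pverts G. nbhd G v \<noteq> {})"

text \<open>The cycle \<open>C\<^sub>n\<close>; a simple graph only for \<open>n \<noteq> 1\<close>, and a cycle only for \<open>n \<ge> 3\<close>.\<close>

definition cycle_graph :: "nat \<Rightarrow> nat pair_pre_digraph" where
  "cycle_graph n =
     \<lparr> pverts = {..<n},
       parcs = {(i, j). i < n \<and> j < n \<and> (j = Suc i mod n \<or> i = Suc j mod n)} \<rparr>"

text \<open>
  \<open>G/uv\<close>: \<^const>\<open>None\<close> is the new vertex, and \<open>Some x\<close> is the surviving vertex \<open>x\<close>.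
\<close>

definition contract_edge :: "'a pair_pre_digraph \<Rightarrow> 'a \<Rightarrow> 'a \<Rightarrow> 'a option pair_pre_digraph" where
  "contract_edge G u v =
     \<lparr> pverts = insert None (Some ` (pverts G - {u, v})),
       parcs = {(Some x, Some y) | x y. (x, y) \<in> parcs G \<and> x \<notin> {u, v} \<and> y \<notin> {u, v}}
             \<union> {(None, Some x) | x. x \<in> (nbhd G u \<union> nbhd G v) - {u, v}}
             \<union> {(Some x, None) | x. x \<in> (nbhd G u \<union> nbhd G v) - {u, v}} \<rparr>"

datatype c5_vertex = Vr | Vs | Vt | Vu | Vv

definition c5_edges :: "c5_vertex rel" where
  "c5_edges = {(Vr, Vs), (Vs, Vt), (Vt, Vu), (Vu, Vv), (Vv, Vr)}"

text \<open>
  The 5-cycle \<open>r s t u v\<close> together with an independent set of additional vertices, one for each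
  entry of the list \<open>Ns\<close>: the vertex \<open>Inr i\<close> has neighbourhood \<open>Ns ! i\<close>.
\<close>

definition c5_extension :: "c5_vertex set list \<Rightarrow> (c5_vertex + nat) pair_pre_digraph" where
  "c5_extension Ns =
     \<lparr> pverts = range Inl \<union> Inr ` {..<length Ns},
       parcs = {(Inl x, Inl y) | x y. (x, y) \<in> c5_edges \<or> (y, x) \<in> c5_edges}
             \<union> {(Inr i, Inl x) | i x. i < length Ns \<and> x \<in> Ns ! i}
             \<union> {(Inl x, Inr i) | i x. i < length Ns \<and> x \<in> Ns ! i} \<rparr>"

lemma pair_graph_cycle_graph:
  assumes "n \<ge> 3"
  shows "pair_graph (cycle_graph n)"
proof -
  have "finite (parcs (cycle_graph n))"
    by (rule finite_subset[of _ "{..<n} \<times> {..<n}"]) (auto simp: cycle_graph_def)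
  moreover have "i \<noteq> Suc i mod n" if "i < n" for i
    using that assms by (cases "Suc i = n") auto
  ultimately show ?thesis
    by unfold_locales (simp_all add: cycle_graph_def symmetric_def sym_def split_beta, metis+)
qed

lemma pair_graph_contract_edge:
  assumes "pair_graph G"
  shows "pair_graph (contract_edge G u v)"
proof -
  interpret pair_graph G by fact
  have wf: "pair_wf_digraph (contract_edge G u v)"
    by unfold_locales (auto simp: contract_edge_def nbhd_def dest: in_arcsD1 in_arcsD2)
  have fv: "finite (pverts (contract_edge G u v))"
    using pair_finite_verts by (auto simp: contract_edge_def)
  have "parcs (contract_edge G u v)
          \<subseteq> pverts (contract_edge G u v) \<times> pverts (contract_edge G u v)"
    using pair_wf_digraph.arc_fst_in_verts[OF wf] pair_wf_digraph.arc_snd_in_verts[OF wf]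
    by force
  then have fa: "finite (parcs (contract_edge G u v))"
    using fv finite_subset by blast
  interpret H: pair_wf_digraph "contract_edge G u v" by (fact wf)
  show ?thesis
    using fv fa
    by unfold_locales
       (auto simp: contract_edge_def symmetric_def intro!: symI
             dest: arcs_symmetric no_loops')
qed

lemma pair_graph_c5_extension: "pair_graph (c5_extension Ns)"
proof -
  have univ: "UNIV = {Vr, Vs, Vt, Vu, Vv}"
    using c5_vertex.exhaust by auto
  then have fin: "finite (UNIV :: c5_vertex set)"
    by (metis finite.emptyI finite.insertI)
  let ?V = "pverts (c5_extension Ns)"
  have fv: "finite ?V"
    using fin by (auto simp: c5_extension_def)
  have "parcs (c5_extension Ns) \<subseteq> ?V \<times> ?V"
    by (auto simp: c5_extension_def)
  then have fa: "finite (parcs (c5_extension Ns))"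
    using fv finite_subset by blast
  show ?thesis
    using fv fa
    by unfold_locales
       (auto simp: c5_extension_def c5_edges_def symmetric_def intro!: symI)
qed

end

theory Submission
  imports Defs
begin

text \<open>
  Contracting an edge can create an induced \<open>C\<^sub>5\<close> only by shortening an induced \<open>C\<^sub>6\<close>, which gives
  one direction. For the other, suppose that no \<open>G/e\<close> contains an induced \<open>C\<^sub>5\<close>, and let \<open>D\<close> be any
  induced \<open>C\<^sub>5\<close> of \<open>G\<close>. Contracting an edge that avoids \<open>D\<close> keeps \<open>D\<close>, so the vertices off \<open>D\<close> are
  independent; contracting an edge from \<open>D\<close> to a vertex \<open>x\<close> off \<open>D\<close> shows that \<open>x\<close> has two
  non-adjacent neighbours on \<open>D\<close>. This leaves 16 possible neighbourhoods. If \<open>x\<close> is a twin of a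
  vertex of \<open>D\<close>, or if \<open>x\<close>, \<open>z\<close>, an edge of \<open>D\<close> and the vertex of \<open>D\<close> opposite to it form an
  induced \<open>C\<^sub>5\<close>, then independence off this new cycle restricts the neighbourhoods of all the
  other vertices. These restrictions leave exactly the six families, up to the symmetries of \<open>D\<close>.
\<close>

section \<open>Induced subgraphs as injections that preserve and reflect adjacency\<close>

lemma graph_iso_commute:
  assumes "pair_wf_digraph G" "pair_wf_digraph H"
  shows "graph_iso G H \<longleftrightarrow> graph_iso H G"
  using assms by (auto simp: graph_iso_def wf_digraph_wp_iff intro: digraph_iso_swap)

text \<open>An induced subgraph is determined by its vertex set \<open>S\<close>; it is
  \<open>?R S\<close> in the proof. A copy of \<open>H\<close> is therefore an isomorphism onto some
  \<open>?R S\<close>, and \<open>S\<close> may be taken as the image of the map.\<close>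

lemma induced_free_iff:
  assumes "pair_wf_digraph H" "pair_wf_digraph G"
  shows "induced_free H G \<longleftrightarrow>
    \<not> (\<exists>f. inj_on f (pverts H) \<and> f ` pverts H \<subseteq> pverts G \<and>
      (\<forall>x \<in> pverts H. \<forall>y \<in> pverts H. (x, y) \<in> parcs H \<longleftrightarrow> (f x, f y) \<in> parcs G))"
    (is "_ \<longleftrightarrow> \<not> (\<exists>f. ?P f)")
proof -
  interpret H: pair_wf_digraph H by fact
  interpret G: pair_wf_digraph G by fact
  let ?R = "\<lambda>S. \<lparr>pverts = S, parcs = {e \<in> parcs G. fst e \<in> S \<and> snd e \<in> S}\<rparr>"
  have wf: "pair_wf_digraph (?R S)" for S
    by unfold_locales auto
  have induced: "induced_subgraph K (with_proj G) \<longleftrightarrow> (\<exists>S \<subseteq> pverts G. K = with_proj (?R S))" for K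
  proof
    assume K: "induced_subgraph K (with_proj G)"
    then have "verts K \<subseteq> pverts G" "K = with_proj (?R (verts K))"
      by (auto simp: induced_subgraph_def subgraph_def compatible_def with_proj_def
          intro!: pre_digraph.equality)
    then show "\<exists>S \<subseteq> pverts G. K = with_proj (?R S)"
      by blast
  next
    assume "\<exists>S \<subseteq> pverts G. K = with_proj (?R S)"
    then show "induced_subgraph K (with_proj G)"
      by (auto simp: induced_subgraph_def subgraph_def compatible_def wf_digraph_wp_iff wf
          G.pair_wf_digraph_axioms)
  qed
  have "(\<exists>S \<subseteq> pverts G. graph_iso (?R S) H) \<longleftrightarrow> (\<exists>S \<subseteq> pverts G. graph_iso H (?R S))"
    using graph_iso_commute[OF wf assms(1)] by simp
  also have "\<dots> \<longleftrightarrow> (\<exists>f. ?P f)"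
  proof
    assume "\<exists>S \<subseteq> pverts G. graph_iso H (?R S)"
    then obtain S f where "S \<subseteq> pverts G" "bij_betw f (pverts H) S"
      "\<And>x y. x \<in> pverts H \<Longrightarrow> y \<in> pverts H \<Longrightarrow>
        (x, y) \<in> parcs H \<longleftrightarrow> (f x, f y) \<in> parcs G \<and> f x \<in> S \<and> f y \<in> S"
      by (auto simp: graph_iso_iff[OF assms(1) wf])
    then have "?P f"
      by (auto simp: bij_betw_def)
    then show "\<exists>f. ?P f"
      by (rule exI[where x = f])
  next
    assume "\<exists>f. ?P f"
    then obtain f where f: "?P f"
      by (elim exE)
    then have "graph_iso H (?R (f ` pverts H))"
      unfolding graph_iso_iff[OF assms(1) wf] by (intro exI[where x = f]) (auto simp: bij_betw_def)
    then show "\<exists>S \<subseteq> pverts G. graph_iso H (?R S)"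
      using f by blast
  qed
  finally have "(\<exists>S \<subseteq> pverts G. graph_iso (?R S) H) \<longleftrightarrow> (\<exists>f. ?P f)" .
  moreover have "induced_free H G \<longleftrightarrow> \<not> (\<exists>S \<subseteq> pverts G. graph_iso (?R S) H)"
    unfolding induced_free_def induced graph_iso_def by blast
  ultimately show ?thesis
    by (simp only:)
qed

section \<open>Induced C5 and C6 as ordered tuples of vertices\<close>

text \<open>Each pair is listed in one orientation, which determines adjacency in a symmetric graph.
  Distinctness is a consequence (\<open>c5_distinct\<close>).\<close>

definition c5 :: "'a pair_pre_digraph \<Rightarrow> 'a \<Rightarrow> 'a \<Rightarrow> 'a \<Rightarrow> 'a \<Rightarrow> 'a \<Rightarrow> bool" where
  "c5 G r s t u v \<longleftrightarrow>
     {(r, s), (s, t), (t, u), (u, v), (v, r)} \<subseteq> parcs G \<and>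
     {(r, t), (s, u), (t, v), (u, r), (v, s)} \<inter> parcs G = {}"

context pair_graph
begin

lemma adj_sym: "(x, y) \<in> parcs G \<longleftrightarrow> (y, x) \<in> parcs G"
  using arcs_symmetric by blast

lemma not_adj_self: "(x, x) \<notin> parcs G"
  using no_loops' by blast

text \<open>Together with \<open>c5_reflect\<close> this generates the ten symmetries of the cycle,
  by which later results are transferred to other labellings.\<close>

lemma c5_rotate: "c5 G r s t u v \<Longrightarrow> c5 G s t u v r"
  by (auto simp: c5_def)

lemma c5_reflect: "c5 G r s t u v \<Longrightarrow> c5 G v u t s r"
  using adj_sym by (auto simp: c5_def)

text \<open>Consecutive vertices differ because there are no loops. If two non-consecutive ones
  coincided, a required arc would become a forbidden one.\<close>

lemma c5_distinct:
  assumes "c5 G r s t u v"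
  shows "distinct [r, s, t, u, v]"
  using assms adj_sym no_loops' by (auto simp: c5_def)

lemma c5_verts:
  assumes "c5 G r s t u v"
  shows "{r, s, t, u, v} \<subseteq> pverts G"
  using assms in_arcsD1 by (auto simp: c5_def)

lemma induced_free_C5_iff: "induced_free (cycle_graph 5) G \<longleftrightarrow> (\<nexists>r s t u v. c5 G r s t u v)"
proof -
  have wf: "pair_wf_digraph (cycle_graph 5)"
    using pair_graph_cycle_graph[of 5]
    by (simp add: pair_graph.axioms pair_digraph.axioms pair_fin_digraph.axioms)
  have verts: "pverts (cycle_graph 5) = {0, 1, 2, 3, 4}"
    by (auto simp: cycle_graph_def)
  have arcs: "(i, j) \<in> parcs (cycle_graph 5) \<longleftrightarrow>
      i < 5 \<and> j < 5 \<and> (j = Suc i mod 5 \<or> i = Suc j mod 5)"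
    for i j
    by (auto simp: cycle_graph_def)
  have "(\<exists>f. inj_on f {0, 1, 2, 3, 4} \<and> f ` {0, 1, 2, 3, 4} \<subseteq> pverts G \<and>
      (\<forall>i \<in> {0, 1, 2, 3, 4}. \<forall>j \<in> {0, 1, 2, 3, 4}.
        (i, j) \<in> parcs (cycle_graph 5) \<longleftrightarrow> (f i, f j) \<in> parcs G))
    \<longleftrightarrow> (\<exists>r s t u v. c5 G r s t u v)" (is "(\<exists>f. ?P f) \<longleftrightarrow> _")
  proof
    assume "\<exists>f. ?P f"
    then obtain f where "?P f"
      by (elim exE)
    then have "c5 G (f 0) (f 1) (f 2) (f 3) (f 4)"
      by (simp add: c5_def arcs)
    then show "\<exists>r s t u v. c5 G r s t u v"
      by blast
  next
    assume "\<exists>r s t u v. c5 G r s t u v"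
    then obtain r s t u v where c: "c5 G r s t u v"
      by blast
    let ?f = "\<lambda>i. [r, s, t, u, v] ! i"
    have "inj_on ?f {0, 1, 2, 3, 4}"
      using c5_distinct[OF c] by (intro inj_on_nth) auto
    moreover have "?f ` {0, 1, 2, 3, 4} \<subseteq> pverts G"
      using c5_verts[OF c] by simp
    moreover have "\<forall>i \<in> {0, 1, 2, 3, 4}. \<forall>j \<in> {0, 1, 2, 3, 4}.
        (i, j) \<in> parcs (cycle_graph 5) \<longleftrightarrow> (?f i, ?f j) \<in> parcs G"
      using c c5_reflect[OF c] not_adj_self by (simp add: arcs c5_def)
    ultimately have "?P ?f"
      by (intro conjI)
    then show "\<exists>f. ?P f"
      by (rule exI[where x = ?f])
  qed
  then show ?thesis
    by (simp only: induced_free_iff[OF wf pair_wf_digraph_axioms] verts)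
qed

lemma not_induced_free_C6:
  assumes arc: "{(a, b), (b, c), (c, d), (d, e), (e, f), (f, a)} \<subseteq> parcs G"
    and non: "{(a, c), (a, d), (a, e), (b, d), (b, e), (b, f), (c, e), (c, f), (d, f)} \<inter> parcs G = {}"
  shows "\<not> induced_free (cycle_graph 6) G"
proof -
  have wf: "pair_wf_digraph (cycle_graph 6)"
    using pair_graph_cycle_graph[of 6]
    by (simp add: pair_graph.axioms pair_digraph.axioms pair_fin_digraph.axioms)
  have verts: "pverts (cycle_graph 6) = {0, 1, 2, 3, 4, 5}"
    by (auto simp: cycle_graph_def)
  have arcs: "(i, j) \<in> parcs (cycle_graph 6) \<longleftrightarrow>
      i < 6 \<and> j < 6 \<and> (j = Suc i mod 6 \<or> i = Suc j mod 6)"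
    for i j
    by (auto simp: cycle_graph_def)
  let ?f = "\<lambda>i::nat. [a, b, c, d, e, f] ! i"
  have sym: "{(b, a), (c, b), (d, c), (e, d), (f, e), (a, f)} \<subseteq> parcs G"
      "{(c, a), (d, a), (e, a), (d, b), (e, b), (f, b), (e, c), (f, c), (f, d)} \<inter> parcs G = {}"
    using arc non adj_sym by auto
  have "distinct [a, b, c, d, e, f]"
    using arc non sym no_loops' by auto
  then have "inj_on ?f {0, 1, 2, 3, 4, 5}"
    by (intro inj_on_nth) auto
  moreover have "?f ` {0, 1, 2, 3, 4, 5} \<subseteq> pverts G"
    using arc in_arcsD1 by auto
  moreover have "\<forall>i \<in> {0, 1, 2, 3, 4, 5}. \<forall>j \<in> {0, 1, 2, 3, 4, 5}.
      (i, j) \<in> parcs (cycle_graph 6) \<longleftrightarrow> (?f i, ?f j) \<in> parcs G"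
    using arc non sym not_adj_self by (simp add: arcs)
  ultimately show ?thesis
    unfolding induced_free_iff[OF wf pair_wf_digraph_axioms] verts by blast
qed

end

section \<open>Contractions of graphs free of C5 and C6\<close>

lemma in_contract_edge [simp]:
  "(Some x, Some y) \<in> parcs (contract_edge G p q) \<longleftrightarrow> (x, y) \<in> parcs G \<and> x \<notin> {p, q} \<and> y \<notin> {p, q}"
  "(None, Some x) \<in> parcs (contract_edge G p q) \<longleftrightarrow> x \<notin> {p, q} \<and> ((p, x) \<in> parcs G \<or> (q, x) \<in> parcs G)"
  "(Some x, None) \<in> parcs (contract_edge G p q) \<longleftrightarrow> x \<notin> {p, q} \<and> ((p, x) \<in> parcs G \<or> (q, x) \<in> parcs G)"
  "(None, None) \<notin> parcs (contract_edge G p q)"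
  by (auto simp: contract_edge_def nbhd_def)

context pair_graph
begin

text \<open>Off the new vertex, the cycle is an induced path \<open>w x y z\<close> of
  \<open>G\<close>. Neither \<open>p\<close> nor \<open>q\<close> sees its inner vertices, and each
  end is seen by one of them. If one of \<open>p\<close>, \<open>q\<close> sees both ends, it closes
  the path to an induced C5; otherwise each sees exactly one end, and \<open>p\<close>,
  \<open>q\<close> together close it to an induced C6.\<close>

lemma c5_contract_edge_None:
  assumes free: "\<nexists>r s t u v. c5 G r s t u v" "induced_free (cycle_graph 6) G"
    and pq: "(p, q) \<in> parcs G"
  shows "\<not> c5 (contract_edge G p q) None a b c d"
proof
  interpret C: pair_graph "contract_edge G p q"
    using pair_graph_contract_edge[OF pair_graph_axioms] .
  assume c: "c5 (contract_edge G p q) None a b c d"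
  then have "distinct [None, a, b, c, d]"
    by (rule C.c5_distinct)
  then obtain w x y z where [simp]: "a = Some w" "b = Some x" "c = Some y" "d = Some z"
    by (cases a; cases b; cases c; cases d) auto
  have path: "(w, x) \<in> parcs G" "(x, y) \<in> parcs G" "(y, z) \<in> parcs G"
      "(w, y) \<notin> parcs G" "(x, z) \<notin> parcs G" "(z, w) \<notin> parcs G"
    and ends: "(p, w) \<in> parcs G \<or> (q, w) \<in> parcs G" "(p, z) \<in> parcs G \<or> (q, z) \<in> parcs G"
    and mid: "(p, x) \<notin> parcs G" "(p, y) \<notin> parcs G" "(q, x) \<notin> parcs G" "(q, y) \<notin> parcs G"
    using c by (auto simp: c5_def)
  have "\<not> c5 G c w x y z" for c
    using free(1) by blast
  from this[of p] this[of q]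
  have "\<not> ((p, w) \<in> parcs G \<and> (p, z) \<in> parcs G)" "\<not> ((q, w) \<in> parcs G \<and> (q, z) \<in> parcs G)"
    using path mid by (auto simp: c5_def adj_sym[of z] adj_sym[of x p] adj_sym[of x q]
        adj_sym[of y p] adj_sym[of y q])
  with ends consider
      "(p, w) \<in> parcs G" "(q, z) \<in> parcs G" "(q, w) \<notin> parcs G" "(p, z) \<notin> parcs G"
    | "(q, w) \<in> parcs G" "(p, z) \<in> parcs G" "(p, w) \<notin> parcs G" "(q, z) \<notin> parcs G"
    by blast
  then show False
  proof cases
    case 1
    have "\<not> induced_free (cycle_graph 6) G"
      by (rule not_induced_free_C6[of p w x y z q])
         (use 1 path mid pq in \<open>simp_all add: adj_sym[of _ q] adj_sym[of w z]\<close>)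
    then show False
      using free by simp
  next
    case 2
    have "\<not> induced_free (cycle_graph 6) G"
      by (rule not_induced_free_C6[of q w x y z p])
         (use 2 path mid pq in \<open>simp_all add: adj_sym[of _ p] adj_sym[of w z]\<close>)
    then show False
      using free by simp
  qed
qed

text \<open>If the new vertex is on the cycle, a rotation brings it to the front, where
  \<open>c5_contract_edge_None\<close> applies. If it is not, the cycle already lies in
  \<open>G\<close>.\<close>

lemma contract_edge_C5_free:
  assumes free: "induced_free (cycle_graph 5) G" "induced_free (cycle_graph 6) G"
    and pq: "(p, q) \<in> parcs G"
  shows "induced_free (cycle_graph 5) (contract_edge G p q)"
proof -
  interpret C: pair_graph "contract_edge G p q"
    using pair_graph_contract_edge[OF pair_graph_axioms] .
  have free5: "\<nexists>r s t u v. c5 G r s t u v"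
    using free(1) induced_free_C5_iff by simp
  note none = c5_contract_edge_None[OF free5 free(2) pq]
  have False if c: "c5 (contract_edge G p q) a b c d e" for a b c d e
  proof -
    note rot = C.c5_rotate[OF c] C.c5_rotate[OF C.c5_rotate[OF c]]
      C.c5_rotate[OF C.c5_rotate[OF C.c5_rotate[OF c]]]
      C.c5_rotate[OF C.c5_rotate[OF C.c5_rotate[OF C.c5_rotate[OF c]]]]
    have "None \<notin> {a, b, c, d, e}"
      using none c rot by blast
    then obtain r s t u v where "a = Some r" "b = Some s" "c = Some t" "d = Some u" "e = Some v"
      by (cases a; cases b; cases c; cases d; cases e) auto
    then have "c5 G r s t u v"
      using c by (auto simp: c5_def)
    then show False
      using free5 by blast
  qed
  then show ?thesis
    unfolding C.induced_free_C5_iff by blast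
qed

end

section \<open>Neighbourhoods of the vertices off an induced C5\<close>

locale c5_critical = pair_graph +
  assumes no_isolated: "no_isolated G"
    and contract_C5_free: "(x, y) \<in> parcs G \<Longrightarrow> induced_free (cycle_graph 5) (contract_edge G x y)"
begin

lemma not_c5_contract:
  assumes "(x, y) \<in> parcs G"
  shows "\<not> c5 (contract_edge G x y) a b c d e"
proof -
  interpret C: pair_graph "contract_edge G x y"
    using pair_graph_contract_edge[OF pair_graph_axioms] .
  show ?thesis
    using contract_C5_free[OF assms] C.induced_free_C5_iff by blast
qed

text \<open>The cycle would survive the contraction of an edge avoiding it. The lemma is also
  applied to new cycles built from an old one, and this is what restricts the neighbourhoods
  further.\<close>

lemma independent_off_c5:
  assumes "c5 G r s t u v" "(x, y) \<in> parcs G" "x \<notin> {r, s, t, u, v}"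
  shows "y \<in> {r, s, t, u, v}"
proof (rule ccontr)
  assume "y \<notin> {r, s, t, u, v}"
  then have "c5 (contract_edge G x y) (Some r) (Some s) (Some t) (Some u) (Some v)"
    using assms by (auto simp: c5_def)
  then show False
    using not_c5_contract assms(2) by blast
qed

text \<open>After contracting \<open>x\<close> into \<open>r\<close>, the new vertex replaces
  \<open>r\<close> on the cycle. The result is an induced C5 unless \<open>x\<close> brings in an
  adjacency to \<open>t\<close> or \<open>u\<close>, the two vertices of the cycle not adjacent to
  \<open>r\<close>.\<close>

lemma adj_c5_two:
  assumes c: "c5 G r s t u v" and x: "x \<notin> {r, s, t, u, v}" and xr: "(x, r) \<in> parcs G"
  shows "(x, t) \<in> parcs G \<or> (x, u) \<in> parcs G"
proof (rule ccontr)
  assume "\<not> ?thesis"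
  then have "c5 (contract_edge G x r) None (Some s) (Some t) (Some u) (Some v)"
    using c x c5_distinct[OF c] adj_sym[of r v] adj_sym[of r u] by (auto simp: c5_def)
  then show False
    using not_c5_contract xr by blast
qed

text \<open>Independence confines the neighbourhood to the cycle, and \<open>adj_c5_two\<close>
  gives every member a partner not adjacent to it. The nonempty sets left are the five non-adjacent
  pairs, the five triples of an edge and its opposite vertex, the five quadruples, and the whole
  cycle.\<close>

lemma nbhd_off_c5:
  assumes c: "c5 G r s t u v" and x: "x \<in> pverts G - {r, s, t, u, v}"
  shows "nbhd G x \<in>
    {{r, t}, {s, u}, {t, v}, {r, u}, {s, v},
     {r, t, u}, {s, u, v}, {r, t, v}, {r, s, u}, {s, t, v},
     {s, t, u, v}, {r, t, u, v}, {r, s, u, v}, {r, s, t, v}, {r, s, t, u},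
     {r, s, t, u, v}}"
proof -
  have "nbhd G x \<subseteq> {r, s, t, u, v}"
    using independent_off_c5[OF c, of x] x by (auto simp: nbhd_def)
  \<comment> \<open>In this form a split on the five adjacencies computes the set by
    simplification.\<close>
  then have N: "nbhd G x = (if (x, r) \<in> parcs G then {r} else {}) \<union>
      ((if (x, s) \<in> parcs G then {s} else {}) \<union> ((if (x, t) \<in> parcs G then {t} else {}) \<union>
      ((if (x, u) \<in> parcs G then {u} else {}) \<union> (if (x, v) \<in> parcs G then {v} else {}))))"
    by (auto simp: nbhd_def)
  have "nbhd G x \<noteq> {}"
    using no_isolated x by (auto simp: no_isolated_def)
  note c1 = c5_rotate[OF c]
  note c2 = c5_rotate[OF c1]
  note c3 = c5_rotate[OF c2]
  note c4 = c5_rotate[OF c3]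
  have "(x, r) \<in> parcs G \<Longrightarrow> (x, t) \<in> parcs G \<or> (x, u) \<in> parcs G"
    "(x, s) \<in> parcs G \<Longrightarrow> (x, u) \<in> parcs G \<or> (x, v) \<in> parcs G"
    "(x, t) \<in> parcs G \<Longrightarrow> (x, v) \<in> parcs G \<or> (x, r) \<in> parcs G"
    "(x, u) \<in> parcs G \<Longrightarrow> (x, r) \<in> parcs G \<or> (x, s) \<in> parcs G"
    "(x, v) \<in> parcs G \<Longrightarrow> (x, s) \<in> parcs G \<or> (x, t) \<in> parcs G"
    using x adj_c5_two[OF c, of x] adj_c5_two[OF c1, of x] adj_c5_two[OF c2, of x]
      adj_c5_two[OF c3, of x] adj_c5_two[OF c4, of x]
    by simp_all
  then show ?thesis
    using \<open>nbhd G x \<noteq> {}\<close> unfolding N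
    by (cases "(x, r) \<in> parcs G"; cases "(x, s) \<in> parcs G"; cases "(x, t) \<in> parcs G";
        cases "(x, u) \<in> parcs G"; cases "(x, v) \<in> parcs G")
       (simp_all add: insert_commute)
qed

text \<open>Here \<open>x\<close> is a twin of \<open>s\<close>, so it can replace \<open>s\<close>
  on the cycle. Then \<open>s\<close> and \<open>y\<close> are both off the new cycle and hence not
  adjacent.\<close>

lemma nbhd_twin:
  assumes c: "c5 G r s t u v" and x: "x \<notin> {r, s, t, u, v}" "nbhd G x = {r, t}"
    and y: "y \<notin> {r, s, t, u, v}" "y \<noteq> x"
  shows "s \<notin> nbhd G y"
proof
  assume "s \<in> nbhd G y"
  have "\<And>w. (x, w) \<in> parcs G \<longleftrightarrow> w \<in> {r, t}"
    using x(2) by (auto simp: nbhd_def)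
  then have "c5 G r x t u v"
    using c c5_distinct[OF c] by (auto simp: c5_def adj_sym[of _ x])
  moreover have "y \<notin> {r, x, t, u, v}" "s \<notin> {r, x, t, u, v}"
    using x y c5_distinct[OF c] by auto
  ultimately show False
    using independent_off_c5[of r x t u v y s] \<open>s \<in> nbhd G y\<close> by (auto simp: nbhd_def)
qed

text \<open>The vertices \<open>s x u v z\<close> form another induced C5, which \<open>r\<close>,
  \<open>t\<close> and \<open>y\<close> all avoid.\<close>

lemma nbhd_pair:
  assumes c: "c5 G r s t u v"
    and x: "x \<notin> {r, s, t, u, v}" "{s, u} \<subseteq> nbhd G x" "v \<notin> nbhd G x"
    and z: "z \<notin> {r, s, t, u, v}" "{s, v} \<subseteq> nbhd G z" "u \<notin> nbhd G z"
    and y: "y \<notin> {r, s, t, u, v}" "y \<noteq> x" "y \<noteq> z"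
  shows "r \<notin> nbhd G y" "t \<notin> nbhd G y"
proof -
  have "(x, z) \<notin> parcs G"
    using independent_off_c5[OF c] x z by blast
  then have c': "c5 G s x u v z"
    using c x z adj_sym by (auto simp: c5_def nbhd_def)
  have off: "y \<notin> {s, x, u, v, z}" "r \<notin> {s, x, u, v, z}" "t \<notin> {s, x, u, v, z}"
    using x z y c5_distinct[OF c] by auto
  show "r \<notin> nbhd G y" "t \<notin> nbhd G y"
    using independent_off_c5[OF c', of y] off by (auto simp: nbhd_def)
qed

end

section \<open>Recognising a graph as an extension of C5\<close>

text \<open>Listing \<open>X\<close> class by class makes the list of values a concatenation of
  constant blocks, the shape in which the families are given.\<close>

lemma ex_list_grouped_by:
  assumes "finite X" "T ` X \<subseteq> set Ls" "distinct Ls"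
  shows "\<exists>xs. distinct xs \<and> set xs = X \<and>
    map T xs = concat (map (\<lambda>S. replicate (card {x \<in> X. T x = S}) S) Ls)"
  using assms
proof (induction Ls arbitrary: X)
  case Nil
  then show ?case by simp
next
  case (Cons S Ls)
  let ?Y = "{x \<in> X. T x = S}" and ?Z = "{x \<in> X. T x \<noteq> S}"
  have "T ` ?Z \<subseteq> set Ls"
    using Cons.prems(2) by auto
  then obtain zs where zs: "distinct zs" "set zs = ?Z"
    "map T zs = concat (map (\<lambda>S. replicate (card {x \<in> ?Z. T x = S}) S) Ls)"
    using Cons.IH[of ?Z] Cons.prems by auto
  \<comment> \<open>Since \<open>S\<close> does not recur in \<open>Ls\<close>, removing its class
    leaves the other counts unchanged.\<close>
  have "{x \<in> ?Z. T x = S'} = {x \<in> X. T x = S'}" if "S' \<in> set Ls" for S'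
    using Cons.prems(3) that by auto
  then have "map (\<lambda>S'. replicate (card {x \<in> ?Z. T x = S'}) S') Ls =
      map (\<lambda>S'. replicate (card {x \<in> X. T x = S'}) S') Ls"
    by (intro map_cong refl) simp
  then have map_zs: "map T zs = concat (map (\<lambda>S'. replicate (card {x \<in> X. T x = S'}) S') Ls)"
    using zs(3) by (simp only:)
  obtain ys where ys: "distinct ys" "set ys = ?Y"
    using finite_distinct_list[of ?Y] Cons.prems(1) by auto
  then have "map T ys = replicate (card ?Y) S"
    by (intro replicate_eqI) (auto simp: distinct_card[symmetric])
  then have "map T (ys @ zs) = concat (map (\<lambda>S'. replicate (card {x \<in> X. T x = S'}) S') (S # Ls))"
    using map_zs by simp
  moreover have "distinct (ys @ zs)" "set (ys @ zs) = X"
    using ys zs by auto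
  ultimately show ?case
    by blast
qed

context pair_graph
begin

lemma graph_iso_c5_extension:
  assumes c: "c5 G r s t u v"
    and xs: "distinct xs" "set xs = pverts G - {r, s, t, u, v}"
    and indep: "\<And>x y. x \<in> set xs \<Longrightarrow> y \<in> set xs \<Longrightarrow> (x, y) \<notin> parcs G"
  shows "graph_iso G (c5_extension (map (\<lambda>x. case_c5_vertex r s t u v -` nbhd G x) xs))"
proof -
  define h where "h = case_c5_vertex r s t u v"
  let ?E = "c5_extension (map (\<lambda>x. h -` nbhd G x) xs)"
  \<comment> \<open>The isomorphism is built from the extension to \<open>G\<close>, where labels
    and indices name vertices directly, and is reversed at the end.\<close>
  let ?f = "case_sum h ((!) xs)"
  interpret E: pair_graph ?E
    by (rule pair_graph_c5_extension)
  have UNIV_c5: "UNIV = {Vr, Vs, Vt, Vu, Vv}"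
    using c5_vertex.exhaust by auto
  have h: "range h = {r, s, t, u, v}"
    unfolding UNIV_c5 h_def by simp
  have inj_h: "inj h"
    using c5_distinct[OF c] unfolding h_def by (intro injI) (auto split: c5_vertex.splits)
  have nth_xs: "(!) xs ` {..<length xs} = set xs"
    using nth_image[of "length xs" xs] by (simp add: lessThan_atLeast0)
  have h_nth: "h a \<noteq> xs ! i" if "i < length xs" for a i
    using nth_mem[OF that] h[THEN equalityD1, THEN subsetD, OF rangeI[of h a]] unfolding xs(2)
    by auto
  have Inr: "Inr i \<in> pverts ?E \<longleftrightarrow> i < length xs" for i
    by (auto simp: c5_extension_def)
  have "inj_on ?f (pverts ?E)"
  proof (rule inj_onI)
    fix x y assume "x \<in> pverts ?E" "y \<in> pverts ?E" "?f x = ?f y"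
    then show "x = y"
      by (cases x; cases y)
        (simp_all add: Inr inj_eq[OF inj_h] nth_eq_iff_index_eq[OF xs(1)] h_nth h_nth[symmetric])
  qed
  moreover have "?f ` pverts ?E = pverts G"
    using h nth_xs xs(2) c5_verts[OF c] by (auto simp: c5_extension_def image_Un image_image)
  ultimately have bij: "bij_betw ?f (pverts ?E) (pverts G)"
    by (simp add: bij_betw_def)
  have cc: "(Inl a, Inl b) \<in> parcs ?E \<longleftrightarrow> (h a, h b) \<in> parcs G" for a b
    using c c5_reflect[OF c] not_adj_self
    by (cases a; cases b) (simp_all add: c5_extension_def c5_edges_def c5_def h_def)
  have arcs: "(x, y) \<in> parcs ?E \<longleftrightarrow> (?f x, ?f y) \<in> parcs G"
    if "x \<in> pverts ?E" "y \<in> pverts ?E" for x y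
  proof -
    have cn: "(Inl a, Inr i) \<in> parcs ?E \<longleftrightarrow> (h a, xs ! i) \<in> parcs G"
      "(Inr i, Inl a) \<in> parcs ?E \<longleftrightarrow> (xs ! i, h a) \<in> parcs G" if "i < length xs" for a i
      using that adj_sym[of "h a" "xs ! i"] by (simp_all add: c5_extension_def nbhd_def)
    have nn: "(Inr i, Inr j) \<in> parcs ?E \<longleftrightarrow> (xs ! i, xs ! j) \<in> parcs G"
      if "i < length xs" "j < length xs" for i j
      using that indep by (simp add: c5_extension_def)
    show ?thesis
      using that by (cases x; cases y) (simp_all only: cc cn nn Inr sum.case)
  qed
  have "graph_iso ?E G"
    unfolding graph_iso_iff[OF E.pair_wf_digraph_axioms pair_wf_digraph_axioms]
    by (intro exI[where x = ?f]) (simp add: bij arcs)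
  then show ?thesis
    unfolding h_def[symmetric]
    using graph_iso_commute[OF E.pair_wf_digraph_axioms pair_wf_digraph_axioms] by simp
qed

end

context c5_critical
begin

text \<open>\<open>Ls\<close> lists the admissible neighbourhoods as sets of labels. The
  multiplicities \<open>n\<close> are exposed as counts because some families require a type to
  occur exactly once.\<close>

lemma ex_graph_iso_c5_extension:
  fixes Ls :: "c5_vertex set list"
  assumes c: "c5 G r s t u v" and Ls: "distinct Ls"
    and N: "\<And>x. x \<in> pverts G - {r, s, t, u, v} \<Longrightarrow>
      nbhd G x \<in> set (map ((`) (case_c5_vertex r s t u v)) Ls)"
  shows "\<exists>n. (\<forall>S. n S = card {x \<in> pverts G - {r, s, t, u, v}. nbhd G x = case_c5_vertex r s t u v ` S})
    \<and> graph_iso G (c5_extension (concat (map (\<lambda>S. replicate (n S) S) Ls)))"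
proof -
  define h where "h = case_c5_vertex r s t u v"
  let ?X = "pverts G - {r, s, t, u, v}"
  let ?T = "\<lambda>x. h -` nbhd G x"
  note N = N[folded h_def]
  have inj: "inj h"
    using c5_distinct[OF c] unfolding h_def by (intro injI) (auto split: c5_vertex.splits)
  \<comment> \<open>By \<open>N\<close> the neighbourhood is an image under the injection
    \<open>h\<close>, so taking the preimage loses nothing.\<close>
  have T: "?T x = S \<longleftrightarrow> nbhd G x = h ` S" "?T x \<in> set Ls" if x: "x \<in> ?X" for x S
  proof -
    obtain S' where "S' \<in> set Ls" "nbhd G x = h ` S'"
      using N[OF x] by auto
    then show "?T x = S \<longleftrightarrow> nbhd G x = h ` S" "?T x \<in> set Ls"
      using inj by (simp_all add: inj_vimage_image_eq inj_image_eq_iff)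
  qed
  have "?T ` ?X \<subseteq> set Ls"
    using T(2) by blast
  then obtain xs where xs: "distinct xs" "set xs = ?X"
    and map: "map ?T xs = concat (map (\<lambda>S. replicate (card {x \<in> ?X. ?T x = S}) S) Ls)"
    using ex_list_grouped_by[of ?X ?T Ls] Ls pair_finite_verts by blast
  have T': "{x \<in> ?X. ?T x = S} = {x \<in> ?X. nbhd G x = h ` S}" for S
    using T(1) by (intro Collect_cong conj_cong refl)
  have "(x, y) \<notin> parcs G" if "x \<in> set xs" "y \<in> set xs" for x y
    using that independent_off_c5[OF c, of x y] unfolding xs(2) by blast
  then have "graph_iso G (c5_extension (map ?T xs))"
    unfolding h_def by (rule graph_iso_c5_extension[OF c xs])
  then show ?thesis
    unfolding map T' unfolding h_def
    by (intro exI[where x = "\<lambda>S. card {x \<in> ?X. nbhd G x = case_c5_vertex r s t u v ` S}"]) simp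
qed

end

section \<open>Membership in the six families\<close>

definition exceptional :: "'a pair_pre_digraph \<Rightarrow> bool" where
  "exceptional G \<longleftrightarrow>
     graph_iso G (c5_extension [{Vr, Vt, Vu}, {Vs, Vt, Vu, Vv}])
   \<or> (\<exists>k. graph_iso G (c5_extension
           ([{Vr, Vt, Vu}, {Vs, Vu, Vv}] @ replicate k {Vr, Vs, Vu})))
   \<or> (\<exists>k. graph_iso G (c5_extension
           ([{Vr, Vs, Vt, Vu}, {Vs, Vt, Vu, Vv}] @ replicate k {Vr, Vt, Vv})))
   \<or> (\<exists>a b c. graph_iso G (c5_extension
           (replicate a {Vr, Vt} @ replicate b {Vr, Vu} @ replicate c {Vr, Vt, Vu})))
   \<or> (\<exists>a b c d. graph_iso G (c5_extension
           (replicate a {Vr, Vt} @ replicate b {Vr, Vt, Vu} @ replicate c {Vr, Vt, Vv}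
            @ replicate d {Vr, Vt, Vu, Vv})))
   \<or> (\<exists>a b c d f. graph_iso G (c5_extension
           (replicate a {Vr, Vt, Vu} @ replicate b {Vr, Vt, Vv} @ replicate c {Vr, Vs, Vt, Vu}
            @ replicate d {Vr, Vt, Vu, Vv} @ replicate f {Vr, Vs, Vt, Vu, Vv})))"

context c5_critical
begin

text \<open>As in the next two families, some types occur exactly once. Their counts are evaluated
  to 1, using that the listed sets differ.\<close>

lemma exceptional1I:
  assumes c: "c5 G r s t u v"
    and off: "pverts G - {r, s, t, u, v} = {x, y}"
    and x: "nbhd G x = {r, t, u}" and y: "nbhd G y = {s, t, u, v}"
  shows "exceptional G"
proof -
  let ?h = "case_c5_vertex r s t u v"
  let ?X = "pverts G - {r, s, t, u, v}"
  let ?Ls = "[{Vr, Vt, Vu}, {Vs, Vt, Vu, Vv}]"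
  have "nbhd G z \<in> set (map ((`) ?h) ?Ls)" if "z \<in> ?X" for z
    using that x y unfolding off by auto
  moreover have "distinct ?Ls"
    by auto
  ultimately obtain n where n: "\<And>S. n S = card {z \<in> ?X. nbhd G z = ?h ` S}"
    and iso: "graph_iso G (c5_extension (concat (map (\<lambda>S. replicate (n S) S) ?Ls)))"
    using ex_graph_iso_c5_extension[OF c, of ?Ls] by blast
  have ne: "{r, t, u} \<noteq> {s, t, u, v}"
    using c5_distinct[OF c] by auto
  have "{z \<in> ?X. nbhd G z = {r, t, u}} = {x}" "{z \<in> ?X. nbhd G z = {s, t, u, v}} = {y}"
    unfolding off using x y ne by auto
  then have "n {Vr, Vt, Vu} = 1" "n {Vs, Vt, Vu, Vv} = 1"
    by (simp_all add: n)
  then have "graph_iso G (c5_extension ?Ls)"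
    using iso by simp
  then show ?thesis
    unfolding exceptional_def by (rule disjI1)
qed

lemma exceptional2I:
  assumes c: "c5 G r s t u v"
    and xy: "x \<in> pverts G - {r, s, t, u, v}" "y \<in> pverts G - {r, s, t, u, v}"
    and x: "nbhd G x = {r, t, u}" and y: "nbhd G y = {s, u, v}"
    and z: "\<And>z. z \<in> pverts G - {r, s, t, u, v} \<Longrightarrow> z \<noteq> x \<Longrightarrow> z \<noteq> y \<Longrightarrow> nbhd G z = {r, s, u}"
  shows "exceptional G"
proof -
  let ?h = "case_c5_vertex r s t u v"
  let ?X = "pverts G - {r, s, t, u, v}"
  \<comment> \<open>The order matters: the blocks must concatenate to the list in
    \<open>exceptional\<close>.\<close>
  let ?Ls = "[{Vr, Vt, Vu}, {Vs, Vu, Vv}, {Vr, Vs, Vu}]"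
  have "nbhd G z \<in> set (map ((`) ?h) ?Ls)" if "z \<in> ?X" for z
    using z[OF that] x y by (cases "z = x"; cases "z = y") auto
  moreover have "distinct ?Ls"
    by auto
  ultimately obtain n where n: "\<And>S. n S = card {z \<in> ?X. nbhd G z = ?h ` S}"
    and iso: "graph_iso G (c5_extension (concat (map (\<lambda>S. replicate (n S) S) ?Ls)))"
    using ex_graph_iso_c5_extension[OF c, of ?Ls] by blast
  have ne: "{r, t, u} \<noteq> {s, u, v}" "{r, t, u} \<noteq> {r, s, u}" "{s, u, v} \<noteq> {r, s, u}"
    using c5_distinct[OF c] by auto
  have "nbhd G w = {r, t, u} \<longleftrightarrow> w = x" "nbhd G w = {s, u, v} \<longleftrightarrow> w = y" if "w \<in> ?X" for w
    using z[OF that] x y ne ne[symmetric] by (cases "w = x"; cases "w = y"; simp)+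
  then have "{z \<in> ?X. nbhd G z = {r, t, u}} = {x}" "{z \<in> ?X. nbhd G z = {s, u, v}} = {y}"
    using xy by blast+
  then have "n {Vr, Vt, Vu} = 1" "n {Vs, Vu, Vv} = 1"
    by (simp_all add: n)
  then have "graph_iso G (c5_extension
      ([{Vr, Vt, Vu}, {Vs, Vu, Vv}] @ replicate (n {Vr, Vs, Vu}) {Vr, Vs, Vu}))"
    using iso by simp
  then show ?thesis
    unfolding exceptional_def by blast
qed

lemma exceptional3I:
  assumes c: "c5 G r s t u v"
    and xy: "x \<in> pverts G - {r, s, t, u, v}" "y \<in> pverts G - {r, s, t, u, v}"
    and x: "nbhd G x = {r, s, t, u}" and y: "nbhd G y = {s, t, u, v}"
    and z: "\<And>z. z \<in> pverts G - {r, s, t, u, v} \<Longrightarrow> z \<noteq> x \<Longrightarrow> z \<noteq> y \<Longrightarrow> nbhd G z = {r, t, v}"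
  shows "exceptional G"
proof -
  let ?h = "case_c5_vertex r s t u v"
  let ?X = "pverts G - {r, s, t, u, v}"
  let ?Ls = "[{Vr, Vs, Vt, Vu}, {Vs, Vt, Vu, Vv}, {Vr, Vt, Vv}]"
  have "nbhd G z \<in> set (map ((`) ?h) ?Ls)" if "z \<in> ?X" for z
    using z[OF that] x y by (cases "z = x"; cases "z = y") auto
  moreover have "distinct ?Ls"
    by auto
  ultimately obtain n where n: "\<And>S. n S = card {z \<in> ?X. nbhd G z = ?h ` S}"
    and iso: "graph_iso G (c5_extension (concat (map (\<lambda>S. replicate (n S) S) ?Ls)))"
    using ex_graph_iso_c5_extension[OF c, of ?Ls] by blast
  have ne: "{r, s, t, u} \<noteq> {s, t, u, v}" "{r, s, t, u} \<noteq> {r, t, v}" "{s, t, u, v} \<noteq> {r, t, v}"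
    using c5_distinct[OF c] by auto
  have "nbhd G w = {r, s, t, u} \<longleftrightarrow> w = x" "nbhd G w = {s, t, u, v} \<longleftrightarrow> w = y" if "w \<in> ?X" for w
    using z[OF that] x y ne ne[symmetric] by (cases "w = x"; cases "w = y"; simp)+
  then have "{z \<in> ?X. nbhd G z = {r, s, t, u}} = {x}" "{z \<in> ?X. nbhd G z = {s, t, u, v}} = {y}"
    using xy by blast+
  then have "n {Vr, Vs, Vt, Vu} = 1" "n {Vs, Vt, Vu, Vv} = 1"
    by (simp_all add: n)
  then have "graph_iso G (c5_extension
      ([{Vr, Vs, Vt, Vu}, {Vs, Vt, Vu, Vv}] @ replicate (n {Vr, Vt, Vv}) {Vr, Vt, Vv}))"
    using iso by simp
  then show ?thesis
    unfolding exceptional_def by blast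
qed

text \<open>In this family and the next two all multiplicities are free, so any counts
  \<open>n\<close> serve as witnesses.\<close>

lemma exceptional4I:
  assumes c: "c5 G r s t u v"
    and N: "\<And>x. x \<in> pverts G - {r, s, t, u, v} \<Longrightarrow> nbhd G x \<in> {{r, t}, {r, u}, {r, t, u}}"
  shows "exceptional G"
proof -
  let ?Ls = "[{Vr, Vt}, {Vr, Vu}, {Vr, Vt, Vu}]"
  have "nbhd G x \<in> set (map ((`) (case_c5_vertex r s t u v)) ?Ls)"
    if "x \<in> pverts G - {r, s, t, u, v}" for x
    using N[OF that] by simp
  moreover have "distinct ?Ls"
    by auto
  ultimately obtain n :: "c5_vertex set \<Rightarrow> nat"
    where "graph_iso G (c5_extension (concat (map (\<lambda>S. replicate (n S) S) ?Ls)))"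
    using ex_graph_iso_c5_extension[OF c, of ?Ls] by blast
  then show ?thesis
    unfolding exceptional_def list.map concat.simps append_Nil2 by blast
qed

lemma exceptional5I:
  assumes c: "c5 G r s t u v"
    and N: "\<And>x. x \<in> pverts G - {r, s, t, u, v} \<Longrightarrow>
      nbhd G x \<in> {{r, t}, {r, t, u}, {r, t, v}, {r, t, u, v}}"
  shows "exceptional G"
proof -
  let ?Ls = "[{Vr, Vt}, {Vr, Vt, Vu}, {Vr, Vt, Vv}, {Vr, Vt, Vu, Vv}]"
  have "nbhd G x \<in> set (map ((`) (case_c5_vertex r s t u v)) ?Ls)"
    if "x \<in> pverts G - {r, s, t, u, v}" for x
    using N[OF that] by simp
  moreover have "distinct ?Ls"
    by auto
  ultimately obtain n :: "c5_vertex set \<Rightarrow> nat"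
    where "graph_iso G (c5_extension (concat (map (\<lambda>S. replicate (n S) S) ?Ls)))"
    using ex_graph_iso_c5_extension[OF c, of ?Ls] by blast
  then show ?thesis
    unfolding exceptional_def list.map concat.simps append_Nil2 by blast
qed

lemma exceptional6I:
  assumes c: "c5 G r s t u v"
    and N: "\<And>x. x \<in> pverts G - {r, s, t, u, v} \<Longrightarrow>
      nbhd G x \<in> {{r, t, u}, {r, t, v}, {r, s, t, u}, {r, t, u, v}, {r, s, t, u, v}}"
  shows "exceptional G"
proof -
  let ?Ls = "[{Vr, Vt, Vu}, {Vr, Vt, Vv}, {Vr, Vs, Vt, Vu}, {Vr, Vt, Vu, Vv}, {Vr, Vs, Vt, Vu, Vv}]"
  have "nbhd G x \<in> set (map ((`) (case_c5_vertex r s t u v)) ?Ls)"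
    if "x \<in> pverts G - {r, s, t, u, v}" for x
    using N[OF that] by simp
  moreover have "distinct ?Ls"
    by auto
  ultimately obtain n :: "c5_vertex set \<Rightarrow> nat"
    where "graph_iso G (c5_extension (concat (map (\<lambda>S. replicate (n S) S) ?Ls)))"
    using ex_graph_iso_c5_extension[OF c, of ?Ls] by blast
  then show ?thesis
    unfolding exceptional_def list.map concat.simps append_Nil2 by blast
qed

section \<open>Cycles with a twin, and pairs that span a second C5\<close>

text \<open>Here \<open>x\<close> is a twin of \<open>s\<close> and \<open>w\<close> a twin of
  \<open>v\<close>, so every other neighbourhood avoids both \<open>s\<close> and \<open>v\<close>.
  This leaves family 4.\<close>

lemma exceptional_two_twins:
  assumes c: "c5 G r s t u v"
    and x: "x \<in> pverts G - {r, s, t, u, v}" "nbhd G x = {r, t}"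
    and w: "w \<in> pverts G - {r, s, t, u, v}" "nbhd G w = {r, u}"
  shows "exceptional G"
proof (rule exceptional4I[OF c])
  fix y assume y: "y \<in> pverts G - {r, s, t, u, v}"
  have c': "c5 G u v r s t"
    using c5_rotate[OF c5_rotate[OF c5_rotate[OF c]]] .
  show "nbhd G y \<in> {{r, t}, {r, u}, {r, t, u}}"
  proof (cases "y = x \<or> y = w")
    case False
    then have "s \<notin> nbhd G y" "v \<notin> nbhd G y"
      using nbhd_twin[OF c, of x y] nbhd_twin[OF c', of w y] x w y
      by (simp_all add: insert_commute)
    with nbhd_off_c5[OF c y] show ?thesis
      by (elim insertE emptyE) simp_all
  qed (use x w in auto)
qed

text \<open>All other neighbourhoods avoid \<open>s\<close>. Among these, \<open>{r, u}\<close> and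
  \<open>{t, v}\<close> would give a second twin as in \<open>exceptional_two_twins\<close>; the
  rest form family 5.\<close>

lemma exceptional_twin:
  assumes c: "c5 G r s t u v"
    and x: "x \<in> pverts G - {r, s, t, u, v}" "nbhd G x = {r, t}"
  shows "exceptional G"
proof (rule ccontr)
  assume ne: "\<not> exceptional G"
  \<comment> \<open>The reflection fixing \<open>s\<close> takes \<open>{t, v}\<close> to the case
    \<open>{r, u}\<close>.\<close>
  have c': "c5 G t s r v u"
    using c5_reflect[OF c5_rotate[OF c5_rotate[OF c5_rotate[OF c]]]] .
  have "exceptional G"
  proof (rule exceptional5I[OF c])
    fix y assume y: "y \<in> pverts G - {r, s, t, u, v}"
    have "nbhd G y \<noteq> {r, u}"
      using exceptional_two_twins[OF c x y] ne by blast
    moreover have "nbhd G y \<noteq> {t, v}"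
      using exceptional_two_twins[OF c', of x y] x y ne by (simp add: insert_commute) blast
    moreover have "y = x \<or> s \<notin> nbhd G y"
      using nbhd_twin[OF c, of x y] x y by (cases "y = x") simp_all
    ultimately show "nbhd G y \<in> {{r, t}, {r, t, u}, {r, t, v}, {r, t, u, v}}"
      using nbhd_off_c5[OF c y] x(2) by (elim insertE emptyE) simp_all
  qed
  then show False
    using ne by blast
qed

text \<open>\<open>nbhd_pair\<close> applies twice: to the edge \<open>uv\<close> with
  \<open>s\<close>, and to the edge \<open>tu\<close> with \<open>r\<close>. Any third vertex could
  then be adjacent only to \<open>u\<close>, so \<open>x\<close> and \<open>z\<close> are the only
  vertices off the cycle.\<close>

lemma exceptional_pair_BD:
  assumes c: "c5 G r s t u v"
    and x: "x \<in> pverts G - {r, s, t, u, v}" "nbhd G x = {r, s, u}"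
    and z: "z \<in> pverts G - {r, s, t, u, v}" "nbhd G z = {r, s, t, v}"
  shows "exceptional G"
proof -
  have c1: "c5 G u v r s t" and c2: "c5 G v r s t u"
    using c5_rotate c by blast+
  have "y \<in> {x, z}" if y: "y \<in> pverts G - {r, s, t, u, v}" for y
  proof (rule ccontr)
    assume "y \<notin> {x, z}"
    then have "r \<notin> nbhd G y" "t \<notin> nbhd G y" "v \<notin> nbhd G y" "s \<notin> nbhd G y"
      using nbhd_pair[OF c, of x z y] nbhd_pair[OF c2, of z x y] x z y c5_distinct[OF c] by auto
    then show False
      using nbhd_off_c5[OF c y] by auto
  qed
  then have "pverts G - {u, v, r, s, t} = {x, z}"
    using x(1) z(1) by auto
  then show ?thesis
    using exceptional1I[OF c1, of x z] x z by (simp add: insert_commute)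
qed

text \<open>By \<open>nbhd_pair\<close> and the absence of twins, every third vertex has
  neighbourhood \<open>{s, u, v}\<close>, while \<open>x\<close> and \<open>z\<close> each have a
  triple or a quadruple. Two triples give family 2, two quadruples family 3, and the mixed cases
  family 1.\<close>

lemma exceptional_pair:
  assumes c: "c5 G r s t u v"
    and no_twin: "\<And>y. y \<in> pverts G - {r, s, t, u, v} \<Longrightarrow>
      nbhd G y \<notin> {{r, t}, {s, u}, {t, v}, {r, u}, {s, v}}"
    and x: "x \<in> pverts G - {r, s, t, u, v}" "{s, u} \<subseteq> nbhd G x" "v \<notin> nbhd G x"
    and z: "z \<in> pverts G - {r, s, t, u, v}" "{s, v} \<subseteq> nbhd G z" "u \<notin> nbhd G z"
  shows "exceptional G"
proof -
  \<comment> \<open>These labellings match \<open>x\<close> and \<open>z\<close> with family 2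
    (\<open>c1\<close>), family 3 (\<open>c2\<close>), and the mirrored mixed case
    (\<open>c3\<close>, which fixes \<open>s\<close> and swaps \<open>u\<close> with
    \<open>v\<close>).\<close>
  have c1: "c5 G u v r s t"
    using c5_rotate[OF c5_rotate[OF c5_rotate[OF c]]] .
  have c2: "c5 G u t s r v"
    using c5_rotate[OF c5_reflect[OF c]] .
  have c3: "c5 G t s r v u"
    using c5_rotate[OF c2] .
  have d: "distinct [r, s, t, u, v]"
    using c by (rule c5_distinct)
  have x': "nbhd G x = {r, s, u} \<or> nbhd G x = {r, s, t, u}"
    using nbhd_off_c5[OF c x(1)] no_twin[OF x(1)] x(2,3) d by (elim insertE emptyE) simp_all
  have z': "nbhd G z = {s, t, v} \<or> nbhd G z = {r, s, t, v}"
    using nbhd_off_c5[OF c z(1)] no_twin[OF z(1)] z(2,3) d by (elim insertE emptyE) simp_all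
  have y: "nbhd G y = {s, u, v}" if y: "y \<in> pverts G - {r, s, t, u, v}" "y \<noteq> x" "y \<noteq> z" for y
  proof -
    have "r \<notin> nbhd G y" "t \<notin> nbhd G y"
      using nbhd_pair[OF c, of x z y] x z y by simp_all
    with nbhd_off_c5[OF c y(1)] no_twin[OF y(1)] show ?thesis
      by (elim insertE emptyE) simp_all
  qed
  show ?thesis
    using x' z'
  proof (elim disjE)
    assume "nbhd G x = {r, s, u}" "nbhd G z = {s, t, v}"
    then show ?thesis
      by (intro exceptional2I[OF c1, of x z]) (use x z y in \<open>simp_all add: insert_commute\<close>)
  next
    assume "nbhd G x = {r, s, u}" "nbhd G z = {r, s, t, v}"
    then show ?thesis
      using exceptional_pair_BD[OF c x(1) _ z(1)] by simp
  next
    assume "nbhd G x = {r, s, t, u}" "nbhd G z = {s, t, v}"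
    then show ?thesis
      by (intro exceptional_pair_BD[OF c3, of z x]) (use x z in \<open>simp_all add: insert_commute\<close>)
  next
    assume "nbhd G x = {r, s, t, u}" "nbhd G z = {r, s, t, v}"
    then show ?thesis
      by (intro exceptional3I[OF c2, of x z]) (use x z y in \<open>simp_all add: insert_commute\<close>)
  qed
qed

section \<open>The remaining case analysis, without twins or pairs\<close>

lemma exceptional_if_c5:
  assumes c: "c5 G r s t u v"
  shows "exceptional G"
proof (rule ccontr)
  assume ne: "\<not> exceptional G"
  define X where "X = pverts G - {r, s, t, u, v}"
  define P where "P S \<longleftrightarrow> (\<exists>x \<in> X. nbhd G x = S)" for S
  \<comment> \<open>\<open>Q a b c\<close> and \<open>Q a c b\<close>, for an edge \<open>bc\<close> opposite to \<open>a\<close>, are the hypotheses of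
    \<open>exceptional_pair\<close>.\<close>
  define Q where "Q a b c \<longleftrightarrow> (\<exists>x \<in> X. {a, b} \<subseteq> nbhd G x \<and> c \<notin> nbhd G x)" for a b c
  have X: "pverts G - {r, s, t, u, v} = X" "pverts G - {s, t, u, v, r} = X"
    "pverts G - {t, u, v, r, s} = X" "pverts G - {u, v, r, s, t} = X"
    "pverts G - {v, r, s, t, u} = X" "pverts G - {v, u, t, s, r} = X"
    "pverts G - {u, t, s, r, v} = X" "pverts G - {t, s, r, v, u} = X"
    "pverts G - {s, r, v, u, t} = X" "pverts G - {r, v, u, t, s} = X"
    unfolding X_def by auto
  note c1 = c5_rotate[OF c]
  note c2 = c5_rotate[OF c1]
  note c3 = c5_rotate[OF c2]
  note c4 = c5_rotate[OF c3]
  note twin = exceptional_twin[OF c] exceptional_twin[OF c1] exceptional_twin[OF c2]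
    exceptional_twin[OF c3] exceptional_twin[OF c4]
  have no_twin: "nbhd G y \<notin> {{r, t}, {s, u}, {t, v}, {r, u}, {s, v}}" if "y \<in> X" for y
    using twin[unfolded X, of y] that ne by (simp add: insert_commute) blast
  \<comment> \<open>Stated for an arbitrary relabelling; its last premise says that the relabelling
    permutes the five twin neighbourhoods.\<close>
  have no_pair: "\<not> (Q s' u' v' \<and> Q s' v' u')"
    if "c5 G r' s' t' u' v'" "pverts G - {r', s', t', u', v'} = X"
      "{{r', t'}, {s', u'}, {t', v'}, {r', u'}, {s', v'}} =
        {{r, t}, {s, u}, {t, v}, {r, u}, {s, v}}"
    for r' s' t' u' v'
    using exceptional_pair[OF that(1), unfolded that(2,3), OF no_twin] ne unfolding Q_def by blast
  have pairs:
    "\<not> (Q r t u \<and> Q r u t)"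
    "\<not> (Q s u v \<and> Q s v u)"
    "\<not> (Q t v r \<and> Q t r v)"
    "\<not> (Q u r s \<and> Q u s r)"
    "\<not> (Q v s t \<and> Q v t s)"
    by (rule no_pair[OF c4 X(5)] no_pair[OF c X(1)] no_pair[OF c1 X(2)] no_pair[OF c2 X(3)]
          no_pair[OF c3 X(4)]; simp add: insert_commute)+
  have PQ: "Q a b c" if "P S" "a \<in> S" "b \<in> S" "c \<notin> S" for S a b c
    using that unfolding P_def Q_def by blast
  \<comment> \<open>With \<open>a\<close> opposite to the edge \<open>bc\<close>, each triple or
    quadruple yields exactly two of the ten statements \<open>Q a b c\<close>.\<close>
  have Q:
    "P {r, t, u} \<Longrightarrow> Q u r s" "P {r, t, u} \<Longrightarrow> Q t r v"
    "P {s, t, u, v} \<Longrightarrow> Q t v r" "P {s, t, u, v} \<Longrightarrow> Q u s r"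
    "P {s, u, v} \<Longrightarrow> Q v s t" "P {s, u, v} \<Longrightarrow> Q u s r"
    "P {r, t, u, v} \<Longrightarrow> Q u r s" "P {r, t, u, v} \<Longrightarrow> Q v t s"
    "P {r, t, v} \<Longrightarrow> Q r t u" "P {r, t, v} \<Longrightarrow> Q v t s"
    "P {r, s, u, v} \<Longrightarrow> Q v s t" "P {r, s, u, v} \<Longrightarrow> Q r u t"
    "P {r, s, u} \<Longrightarrow> Q s u v" "P {r, s, u} \<Longrightarrow> Q r u t"
    "P {r, s, t, v} \<Longrightarrow> Q r t u" "P {r, s, t, v} \<Longrightarrow> Q s v u"
    "P {s, t, v} \<Longrightarrow> Q t v r" "P {s, t, v} \<Longrightarrow> Q s v u"
    "P {r, s, t, u} \<Longrightarrow> Q s u v" "P {r, s, t, u} \<Longrightarrow> Q t r v"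
    using c5_distinct[OF c] by (auto elim!: PQ)
  \<comment> \<open>The six sets are the triples and quadruples outside family 6. If none occurred,
    \<open>G\<close> would belong to that family.\<close>
  have no_6: "P {s', u', v'} \<or> P {r', s', u'} \<or> P {s', t', v'} \<or>
      P {s', t', u', v'} \<or> P {r', s', u', v'} \<or> P {r', s', t', v'}"
    if c': "c5 G r' s' t' u' v'" and X': "pverts G - {r', s', t', u', v'} = X"
      and twins: "{{r', t'}, {s', u'}, {t', v'}, {r', u'}, {s', v'}} =
        {{r, t}, {s, u}, {t, v}, {r, u}, {s, v}}"
    for r' s' t' u' v'
  proof (rule ccontr)
    assume no: "\<not> ?thesis"
    have "exceptional G"
    proof (rule exceptional6I[OF c'])
      fix x assume x: "x \<in> pverts G - {r', s', t', u', v'}"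
      then have "x \<in> X"
        unfolding X' .
      then have "nbhd G x \<noteq> S" if "\<not> P S" for S
        using that unfolding P_def by blast
      with no have "nbhd G x \<noteq> {s', u', v'}" "nbhd G x \<noteq> {r', s', u'}" "nbhd G x \<noteq> {s', t', v'}"
        "nbhd G x \<noteq> {s', t', u', v'}" "nbhd G x \<noteq> {r', s', u', v'}" "nbhd G x \<noteq> {r', s', t', v'}"
        by blast+
      moreover have "nbhd G x \<notin> {{r', t'}, {s', u'}, {t', v'}, {r', u'}, {s', v'}}"
        using no_twin[OF \<open>x \<in> X\<close>] unfolding twins .
      ultimately show "nbhd G x \<in>
          {{r', t', u'}, {r', t', v'}, {r', s', t', u'}, {r', t', u', v'}, {r', s', t', u', v'}}"
        using nbhd_off_c5[OF c' x] unfolding insert_iff empty_iff by argo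
    qed
    then show False
      using ne by blast
  qed
  note r0 = c5_reflect[OF c]
  note r1 = c5_rotate[OF r0]
  note r2 = c5_rotate[OF r1]
  note r3 = c5_rotate[OF r2]
  note r4 = c5_rotate[OF r3]
  have "P {s, u, v} \<or> P {r, s, u} \<or> P {s, t, v} \<or> P {s, t, u, v} \<or> P {r, s, u, v} \<or> P {r, s, t, v}"
    "P {r, t, v} \<or> P {s, t, v} \<or> P {r, t, u} \<or> P {r, t, u, v} \<or> P {r, s, t, v} \<or> P {r, s, t, u}"
    "P {r, s, u} \<or> P {r, t, u} \<or> P {s, u, v} \<or> P {r, s, u, v} \<or> P {r, s, t, u} \<or> P {s, t, u, v}"
    "P {s, t, v} \<or> P {s, u, v} \<or> P {r, t, v} \<or> P {r, s, t, v} \<or> P {s, t, u, v} \<or> P {r, t, u, v}"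
    "P {r, t, u} \<or> P {r, t, v} \<or> P {r, s, u} \<or> P {r, s, t, u} \<or> P {r, t, u, v} \<or> P {r, s, u, v}"
    "P {s, t, v} \<or> P {r, t, v} \<or> P {s, u, v} \<or> P {s, t, u, v} \<or> P {r, s, t, v} \<or> P {r, s, u, v}"
    "P {r, t, u} \<or> P {r, s, u} \<or> P {r, t, v} \<or> P {r, t, u, v} \<or> P {r, s, t, u} \<or> P {r, s, t, v}"
    "P {s, u, v} \<or> P {s, t, v} \<or> P {r, s, u} \<or> P {r, s, u, v} \<or> P {s, t, u, v} \<or> P {r, s, t, u}"
    "P {r, t, v} \<or> P {r, t, u} \<or> P {s, t, v} \<or> P {r, s, t, v} \<or> P {r, t, u, v} \<or> P {s, t, u, v}"
    "P {r, s, u} \<or> P {s, u, v} \<or> P {r, t, u} \<or> P {r, s, t, u} \<or> P {r, s, u, v} \<or> P {r, t, u, v}"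
    using no_6[OF c X(1)]
      no_6[OF c1 X(2)]
      no_6[OF c2 X(3)]
      no_6[OF c3 X(4)]
      no_6[OF c4 X(5)]
      no_6[OF r4 X(10)]
      no_6[OF r3 X(9)]
      no_6[OF r2 X(8)]
      no_6[OF r1 X(7)]
      no_6[OF r0 X(6)]
    by (simp_all add: insert_commute)
  \<comment> \<open>Assign a triple to its edge, and a quadruple to the edge opposite its missing
    vertex. By \<open>Q\<close> and \<open>pairs\<close>, no edge carries both kinds and adjacent
    edges carry different kinds. As 5 is odd, the sets present fit into an alternating pattern on
    four edges, which is family 6 in one of its ten positions. One of the ten disjunctions therefore
    fails.\<close>
  with Q pairs show False
    by argo
qed

end

theorem theorem36:
  fixes G :: "'a pair_pre_digraph"
  assumes "pair_graph G"
    and "no_isolated G"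
    and "induced_free (cycle_graph 6) G"
    and "\<not> graph_iso G (c5_extension [{Vr, Vt, Vu}, {Vs, Vt, Vu, Vv}])"
    and "\<And>k. \<not> graph_iso G (c5_extension
           ([{Vr, Vt, Vu}, {Vs, Vu, Vv}] @ replicate k {Vr, Vs, Vu}))"
    and "\<And>k. \<not> graph_iso G (c5_extension
           ([{Vr, Vs, Vt, Vu}, {Vs, Vt, Vu, Vv}] @ replicate k {Vr, Vt, Vv}))"
    and "\<And>a b c. \<not> graph_iso G (c5_extension
           (replicate a {Vr, Vt} @ replicate b {Vr, Vu} @ replicate c {Vr, Vt, Vu}))"
    and "\<And>a b c d. \<not> graph_iso G (c5_extension
           (replicate a {Vr, Vt} @ replicate b {Vr, Vt, Vu} @ replicate c {Vr, Vt, Vv}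
            @ replicate d {Vr, Vt, Vu, Vv}))"
    and "\<And>a b c d f. \<not> graph_iso G (c5_extension
           (replicate a {Vr, Vt, Vu} @ replicate b {Vr, Vt, Vv} @ replicate c {Vr, Vs, Vt, Vu}
            @ replicate d {Vr, Vt, Vu, Vv} @ replicate f {Vr, Vs, Vt, Vu, Vv}))"
  shows "induced_free (cycle_graph 5) G \<longleftrightarrow>
         (\<forall>(u, v) \<in> parcs G. induced_free (cycle_graph 5) (contract_edge G u v))"
proof -
  interpret pair_graph G by fact
  have "\<not> exceptional G"
    using assms(4-) unfolding exceptional_def by blast
  show ?thesis
  proof
    assume "induced_free (cycle_graph 5) G"
    then show "\<forall>(u, v) \<in> parcs G. induced_free (cycle_graph 5) (contract_edge G u v)"
      using contract_edge_C5_free assms(3) by blast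
  next
    assume "\<forall>(u, v) \<in> parcs G. induced_free (cycle_graph 5) (contract_edge G u v)"
    then interpret c5_critical G
      using assms(2) by unfold_locales auto
    show "induced_free (cycle_graph 5) G"
      using exceptional_if_c5 \<open>\<not> exceptional G\<close> induced_free_C5_iff by blast
  qed
qed

end
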